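(* By repeated removal of pairs of parallel edges, each reduced partition of $\{1,\ldots,n\}$ ($n\ge1$) may be transformed into a primitive partition. This primitive partition does not depend on the order in which the removals are performed.
   Context: For $n\ge1$ let $\zeta_n=(1,2,\ldots,n)$; additions $i+1$ are modulo $n$, i.e. $i+1$ means $\zeta_n(i)$. Products of permutations are composed right to left. A permutation $\alpha$ of $\{1,\ldots,n\}$ is a partition if each of its cycles, listed beginning with its least element, is an increasing list. An element $i$ is a dual fixed point of $\alpha$ if $\alpha(i)=i+1$ (equivalently, $i$ is a fixed point of $\alpha^{-1}\zeta_n$). A permutation is reduced if it has no fixed points and no dual fixed points. Removing a dual fixed point $i$ (an elementary reduction of the second kind) means: delete $i$ from its cycle in the cycle decomposition of $\alpha$ and replace every $j>i$ by $j-1$, obtaining a permutation of $\{1,\ldots,n-1\}$ (this is also allowed for $i=n$, when $\alpha(n)=1$). For a reduced permutation $\alpha$ and a pair $\{i,j\}\subseteq\{1,\ldots,n\}$ with $\alpha(i)=j+1$ and $\alpha(j)=i+1$, the directed edges $i\to\alpha(i)$ and $j\to\alpha(j)$ are called parallel edges. The removal of this pair of parallel edges from a reduced partition $\alpha$ means: form the permutation $\gamma_{i,j}[\alpha]$ given by $i\mapsto i+1$, $j\mapsto j+1$, and $k\mapsto\alpha(k)$ for $k\notin\{i,j\}$, and then remove its dual fixed points $i$ and $j$ (that is, delete $i$ and $j$ from the cycle decomposition of $\gamma_{i,j}[\alpha]$ and decrease each remaining label $k$ by the number of elements of $\{i,j\}$ that are smaller than $k$, obtaining a permutation of $\{1,\ldots,n-2\}$).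 A reduced partition is primitive if it has no pair of parallel edges. *)

theory Defs
  imports "HOL-Combinatorics.Combinatorics"
begin

text \<open>A permutation of \<open>{1,\<dots>,n}\<close> is a function \<open>\<alpha> :: nat \<Rightarrow> nat\<close> with \<open>\<alpha> permutes {1..n}\<close>,
  hence the identity outside \<open>{1..n}\<close>; so equality of functions is equality of permutations.
  As the degree \<open>n\<close> varies, a permutation is carried around as a pair \<open>(n, \<alpha>)\<close>.\<close>

definition zeta :: "nat \<Rightarrow> nat \<Rightarrow> nat" where
  "zeta n i = (if i \<in> {1..n} then i mod n + 1 else i)"

text \<open>\<open>support \<alpha> a = [a, \<alpha> a, \<alpha> (\<alpha> a), \<dots>]\<close> is the cycle of \<open>\<alpha>\<close> through \<open>a\<close>, listed beginning
  with \<open>a\<close> (a one-element list if \<open>a\<close> is a fixed point).\<close>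

definition perm_partition :: "nat \<Rightarrow> (nat \<Rightarrow> nat) \<Rightarrow> bool" where
  "perm_partition n \<alpha> \<longleftrightarrow> 1 \<le> n \<and> \<alpha> permutes {1..n} \<and>
     (\<forall>a\<in>{1..n}. (\<forall>b\<in>set (support \<alpha> a). a \<le> b) \<longrightarrow> sorted_wrt (<) (support \<alpha> a))"

definition fixed_pt :: "nat \<Rightarrow> (nat \<Rightarrow> nat) \<Rightarrow> nat \<Rightarrow> bool" where
  "fixed_pt n \<alpha> i \<longleftrightarrow> i \<in> {1..n} \<and> \<alpha> i = i"

definition dual_fixed_pt :: "nat \<Rightarrow> (nat \<Rightarrow> nat) \<Rightarrow> nat \<Rightarrow> bool" where
  "dual_fixed_pt n \<alpha> i \<longleftrightarrow> i \<in> {1..n} \<and> \<alpha> i = zeta n i"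

definition reduced_perm :: "nat \<Rightarrow> (nat \<Rightarrow> nat) \<Rightarrow> bool" where
  "reduced_perm n \<alpha> \<longleftrightarrow> (\<nexists>i. fixed_pt n \<alpha> i) \<and> (\<nexists>i. dual_fixed_pt n \<alpha> i)"

definition reduced_partition :: "nat \<Rightarrow> (nat \<Rightarrow> nat) \<Rightarrow> bool" where
  "reduced_partition n \<alpha> \<longleftrightarrow> perm_partition n \<alpha> \<and> reduced_perm n \<alpha>"

text \<open>Deleting \<open>i\<close> from its cycle: the predecessor of \<open>i\<close> is sent to \<open>\<alpha> i\<close>, and \<open>i\<close> becomes fixed.\<close>

definition delete_from_cycle :: "nat \<Rightarrow> (nat \<Rightarrow> nat) \<Rightarrow> nat \<Rightarrow> nat" where
  "delete_from_cycle i \<alpha> k = (if k = i then i else if \<alpha> k = i then \<alpha> i else \<alpha> k)"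

text \<open>Deletion of \<open>i\<close> followed by the relabelling \<open>j \<mapsto> j - 1\<close> for \<open>j > i\<close>: the new label \<open>k\<close> stands
  for the old label \<open>k\<close> if \<open>k < i\<close> and for the old label \<open>k + 1\<close> otherwise.
  If \<open>\<alpha> permutes {1..n}\<close> and \<open>i \<in> {1..n}\<close>, the result permutes \<open>{1..n - 1}\<close>.\<close>

definition remove_point :: "nat \<Rightarrow> (nat \<Rightarrow> nat) \<Rightarrow> nat \<Rightarrow> nat" where
  "remove_point i \<alpha> k =
     (let old = (if k < i then k else k + 1);
          img = delete_from_cycle i \<alpha> old
      in if img > i then img - 1 else img)"

definition parallel_pair :: "nat \<Rightarrow> (nat \<Rightarrow> nat) \<Rightarrow> nat \<Rightarrow> nat \<Rightarrow> bool" where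
  "parallel_pair n \<alpha> i j \<longleftrightarrow>
     i \<in> {1..n} \<and> j \<in> {1..n} \<and> i \<noteq> j \<and> \<alpha> i = zeta n j \<and> \<alpha> j = zeta n i"

definition gamma :: "nat \<Rightarrow> nat \<Rightarrow> nat \<Rightarrow> (nat \<Rightarrow> nat) \<Rightarrow> nat \<Rightarrow> nat" where
  "gamma n i j \<alpha> = \<alpha>(i := zeta n i, j := zeta n j)"

text \<open>The larger point is removed first, so that the smaller one keeps its label; altogether every
  remaining label \<open>k\<close> drops by the number of elements of \<open>{i, j}\<close> below \<open>k\<close>.\<close>

definition remove_pair :: "nat \<Rightarrow> nat \<Rightarrow> nat \<Rightarrow> (nat \<Rightarrow> nat) \<Rightarrow> nat \<Rightarrow> nat" where
  "remove_pair n i j \<alpha> = remove_point (min i j) (remove_point (max i j) (gamma n i j \<alpha>))"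

text \<open>One removal of a pair of parallel edges. Only the source is required to be a reduced partition;
  nothing is imposed on the outcome.\<close>

inductive parallel_removal :: "nat \<times> (nat \<Rightarrow> nat) \<Rightarrow> nat \<times> (nat \<Rightarrow> nat) \<Rightarrow> bool" where
  "reduced_partition n \<alpha> \<Longrightarrow> parallel_pair n \<alpha> i j \<Longrightarrow>
     parallel_removal (n, \<alpha>) (n - 2, remove_pair n i j \<alpha>)"

definition primitive_partition :: "nat \<Rightarrow> (nat \<Rightarrow> nat) \<Rightarrow> bool" where
  "primitive_partition n \<alpha> \<longleftrightarrow> reduced_partition n \<alpha> \<and> (\<nexists>i j. parallel_pair n \<alpha> i j)"

end

theory Submission
  imports Defs "HOL-Library.Confluence"
begin

text \<open>
  Let \<open>{i, j}\<close> be a parallel pair of a reduced partition \<open>\<alpha>\<close>. The points \<open>i\<close> and \<open>j\<close> lie on different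
  cycles, contained in the cyclic intervals \<open>[j + 1, i]\<close> and \<open>[i + 1, j]\<close>; since \<open>\<gamma>\<^sub>i\<^sub>,\<^sub>j[\<alpha>] = \<alpha> \<circ> (i j)\<close>,
  these two cycles are joined into one, which is again cyclically increasing, and no fixed points or
  dual fixed points arise. Hence reduced partitions are stable under removals, and as the degree
  drops, a primitive partition is reached. Two parallel pairs that differ are disjoint, each stays
  parallel after the removal of the other, and both orders of removal give the same result, because
  deleting a point commutes with deleting another one and with composing on the right with a
  transposition not moving it. So removal is confluent.
\<close>

section \<open>Cyclic order, increasing relabellings and the deletion of one point\<close>

definition cyclic_order :: "nat \<Rightarrow> nat \<Rightarrow> nat \<Rightarrow> bool" where
  "cyclic_order x y z \<longleftrightarrow> x < y \<and> y < z \<or> y < z \<and> z < x \<or> z < x \<and> x < y"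

text \<open>Writing \<open>f = g \<circ> s\<close>, the map \<open>s\<close> is strictly increasing,
  so \<open>n \<le> s n\<close> and \<open>g \<le> f\<close>; the rest is symmetry. This later
  identifies the relabellings for two orders of removal without comparing the sizes of the removed
  points.\<close>

lemma strict_mono_range_unique:
  fixes f g :: "nat \<Rightarrow> nat"
  assumes "strict_mono f" "strict_mono g" "range f = range g"
  shows "f = g"
proof -
  have le: "g n \<le> f n"
    if f: "strict_mono f" and g: "strict_mono g" and ran: "range f = range g" for f g :: "nat \<Rightarrow> nat" and n
  proof -
    have "\<exists>m. f k = g m" for k
      using ran by (metis rangeE rangeI)
    then obtain s where s: "\<And>k. f k = g (s k)"
      by metis
    have "strict_mono s"
      by (rule strict_monoI) (metis f g s strict_mono_less)
    then have "n \<le> s n"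
      by (rule strict_mono_imp_increasing)
    then show ?thesis
      using g s by (simp add: strict_mono_less_eq)
  qed
  show ?thesis
    by (rule ext, rule antisym) (simp_all add: le assms)
qed

text \<open>Takes a new label to the old one. As it is injective, equations about
  \<open>remove_point\<close> can be checked in the old labels, where no decrement occurs.\<close>

definition skip :: "nat \<Rightarrow> nat \<Rightarrow> nat" where
  "skip i k = (if k < i then k else k + 1)"

lemma strict_mono_skip: "strict_mono (skip i)"
  by (auto simp: strict_mono_def skip_def)

lemma range_skip: "range (skip i) = - {i}"
proof -
  have "x \<in> range (skip i)" if "x \<noteq> i" for x
    using that by (intro image_eqI[of _ _ "if x < i then x else x - 1"]) (auto simp: skip_def)
  then show ?thesis
    by (auto simp: skip_def)
qed

lemma skip_mem_iff: "i \<in> {1..n} \<Longrightarrow> skip i k \<in> {1..n} \<longleftrightarrow> k \<in> {1..n - 1}"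
  by (auto simp: skip_def)

lemma inj_delete_from_cycle: "inj \<alpha> \<Longrightarrow> inj (delete_from_cycle i \<alpha>)"
  by (rule injI) (auto simp: delete_from_cycle_def inj_eq split: if_splits)

text \<open>In either order an arrow from outside \<open>{i, j}\<close> is prolonged to the first
  point outside \<open>{i, j}\<close>; injectivity ensures that it does not get trapped
  inside.\<close>

lemma delete_from_cycle_commute:
  assumes "inj \<alpha>"
  shows "delete_from_cycle i (delete_from_cycle j \<alpha>) = delete_from_cycle j (delete_from_cycle i \<alpha>)"
  using assms by (intro ext) (auto simp: delete_from_cycle_def inj_eq split: if_splits)

text \<open>The transposition fixes \<open>k\<close>, so it leaves the arrow out of \<open>k\<close>
  alone and only exchanges the sources of two other arrows.\<close>

lemma delete_from_cycle_transpose: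
  assumes "k \<noteq> i" "k \<noteq> j"
  shows "delete_from_cycle k \<alpha> \<circ> transpose i j = delete_from_cycle k (\<alpha> \<circ> transpose i j)"
  using assms by (intro ext) (auto simp: delete_from_cycle_def transpose_def)

text \<open>By injectivity the deletion takes the value \<open>i\<close> only at \<open>i\<close>,
  which is not an old label of any \<open>k\<close>; hence \<open>skip i\<close> undoes the
  decrement.\<close>

lemma skip_remove_point:
  assumes "inj \<alpha>"
  shows "skip i (remove_point i \<alpha> k) = delete_from_cycle i \<alpha> (skip i k)"
proof -
  have "delete_from_cycle i \<alpha> (skip i k) \<noteq> i"
    using assms by (auto simp: delete_from_cycle_def skip_def inj_eq split: if_splits)
  then show ?thesis
    unfolding remove_point_def Let_def skip_def by auto
qed

text \<open>Deletion only tests labels for equality, so it is transported along any injective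
  relabelling.\<close>

lemma skip_delete_from_cycle:
  assumes "\<And>k. skip b (f k) = g (skip b k)"
  shows "skip b (delete_from_cycle a f k) = delete_from_cycle (skip b a) g (skip b k)"
  using strict_mono_eq[OF strict_mono_skip[of b]] assms[symmetric]
  by (simp add: delete_from_cycle_def)

lemma inj_remove_point:
  assumes "inj \<alpha>"
  shows "inj (remove_point i \<alpha>)"
proof (rule injI)
  fix x y
  assume "remove_point i \<alpha> x = remove_point i \<alpha> y"
  then show "x = y"
    using skip_remove_point[OF assms, of i] inj_delete_from_cycle[OF assms, of i]
      strict_mono_eq[OF strict_mono_skip[of i]] by (metis inj_eq)
qed

lemma remove_point_permutes:
  assumes \<alpha>: "\<alpha> permutes {1..n}" and i: "i \<in> {1..n}"
  shows "remove_point i \<alpha> permutes {1..n - 1}"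
proof (rule bij_imp_permutes)
  have inj: "inj \<alpha>"
    using \<alpha> by (rule permutes_inj)
  have mem: "delete_from_cycle i \<alpha> x \<in> {1..n}" if "x \<in> {1..n}" for x
    using that i permutes_in_image[OF \<alpha>] by (auto simp: delete_from_cycle_def)
  have "remove_point i \<alpha> ` {1..n - 1} \<subseteq> {1..n - 1}"
    using mem skip_remove_point[OF inj] skip_mem_iff[OF i] by (metis image_subsetI)
  then show "bij_betw (remove_point i \<alpha>) {1..n - 1} {1..n - 1}"
    by (simp add: bij_betw_def endo_inj_surj inj_on_subset[OF inj_remove_point[OF inj]])
  show "remove_point i \<alpha> x = x" if "x \<notin> {1..n - 1}" for x
  proof -
    have "skip i x \<notin> {1..n}"
      using that skip_mem_iff[OF i] by blast
    then have "skip i (remove_point i \<alpha> x) = skip i x"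
      using i permutes_not_in[OF \<alpha>, of "skip i x"]
      by (auto simp: skip_remove_point[OF inj] delete_from_cycle_def)
    then show ?thesis
      by (simp add: strict_mono_eq[OF strict_mono_skip])
  qed
qed

lemma zeta_permutes: "zeta n permutes {1..n}"
proof (rule bij_imp_permutes)
  have "inj_on (zeta n) {1..n}"
  proof (rule inj_onI)
    fix x y assume "x \<in> {1..n}" "y \<in> {1..n}" "zeta n x = zeta n y"
    then show "x = y"
      by (cases "x = n"; cases "y = n") (auto simp: zeta_def)
  qed
  moreover have "zeta n ` {1..n} \<subseteq> {1..n}"
    by (auto simp: zeta_def Suc_le_eq)
  ultimately show "bij_betw (zeta n) {1..n} {1..n}"
    by (simp add: bij_betw_def endo_inj_surj)
qed (auto simp: zeta_def)

lemma zeta_eq: "i \<in> {1..n} \<Longrightarrow> zeta n i = (if i = n then 1 else i + 1)"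
  by (auto simp: zeta_def)

text \<open>Needed because dual fixed points and parallel pairs refer to \<open>zeta\<close> of the
  current degree: it shrinks by the same operation as the permutation.\<close>

lemma remove_point_zeta:
  assumes "i \<in> {1..n}"
  shows "remove_point i (zeta n) = zeta (n - 1)"
proof (rule ext)
  fix k
  have "skip i (zeta (n - 1) k) = delete_from_cycle i (zeta n) (skip i k)"
  proof (cases "k \<in> {1..n - 1}")
    case True
    then show ?thesis
      using assms by (cases "k = n - 1") (auto simp: zeta_def skip_def delete_from_cycle_def)
  next
    case False
    then show ?thesis
      using assms by (auto simp: zeta_def skip_def delete_from_cycle_def)
  qed
  then show "remove_point i (zeta n) k = zeta (n - 1) k"
    by (metis skip_remove_point[OF permutes_inj[OF zeta_permutes]]
        strict_mono_eq[OF strict_mono_skip])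
qed

section \<open>Deletion of two points\<close>

text \<open>The larger point is removed first, so going back to the old labels reinserts it
  last.\<close>

definition skip_pair :: "nat \<Rightarrow> nat \<Rightarrow> nat \<Rightarrow> nat" where
  "skip_pair i j = skip (max i j) \<circ> skip (min i j)"

lemma strict_mono_skip_pair: "strict_mono (skip_pair i j)"
  unfolding skip_pair_def by (intro strict_mono_o strict_mono_skip)

lemma range_skip_pair:
  assumes "i \<noteq> j"
  shows "range (skip_pair i j) = - {i, j}"
proof -
  have "skip (max i j) (min i j) = min i j"
    using assms by (auto simp: skip_def)
  then have "skip (max i j) ` (- {min i j}) = - {max i j} - {min i j}"
    using range_skip[of "max i j"] strict_mono_imp_inj_on[OF strict_mono_skip[of "max i j"]]
    by (simp add: Compl_eq_Diff_UNIV image_set_diff)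
  then show ?thesis
    unfolding skip_pair_def image_comp[symmetric] range_skip by (auto simp: max_def min_def)
qed

lemma skip_pair_mem_iff:
  assumes "i \<in> {1..n}" "j \<in> {1..n}" "i \<noteq> j"
  shows "skip_pair i j k \<in> {1..n} \<longleftrightarrow> k \<in> {1..n - 2}"
proof -
  have "max i j \<in> {1..n}" "min i j \<in> {1..n - 1}"
    using assms by auto
  then show ?thesis
    by (simp only: skip_pair_def comp_apply skip_mem_iff) (simp add: numeral_2_eq_2)
qed

text \<open>The smaller point keeps its label when the larger one goes, so both deletions can be
  read in the old labels; there they commute, and \<open>max\<close> and \<open>min\<close>
  disappear.\<close>

lemma skip_pair_remove_points:
  assumes "inj g" "i \<noteq> j"
  shows "skip_pair i j (remove_point (min i j) (remove_point (max i j) g) k) =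
    delete_from_cycle i (delete_from_cycle j g) (skip_pair i j k)"
proof -
  have "skip (max i j) (min i j) = min i j"
    using assms by (auto simp: skip_def)
  then have "skip_pair i j (remove_point (min i j) (remove_point (max i j) g) k) =
    delete_from_cycle (min i j) (delete_from_cycle (max i j) g) (skip_pair i j k)"
    using assms unfolding skip_pair_def comp_apply
    by (simp add: skip_remove_point inj_remove_point
        skip_delete_from_cycle[where g = "delete_from_cycle (max i j) g"])
  then show ?thesis
    using delete_from_cycle_commute[OF assms(1), of i j]
    by (cases "i < j") (simp_all add: max_def min_def split: if_splits)
qed

section \<open>Partitions in terms of labels and cyclic order\<close>

text \<open>A label which is constant on cycles replaces the orbits of \<open>\<alpha>\<close>: when two cycles are joined, it only
  has to be changed pointwise. Different cycles may share a label a priori, which is harmless.\<close>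

lemma perm_partition_iff_labelling:
  "perm_partition n \<alpha> \<longleftrightarrow> 1 \<le> n \<and> \<alpha> permutes {1..n} \<and>
    (\<exists>c :: nat \<Rightarrow> nat set. (\<forall>x\<in>{1..n}. c (\<alpha> x) = c x) \<and>
      (\<forall>x\<in>{1..n}. \<forall>y\<in>{1..n}. c x = c y \<longrightarrow> \<not> cyclic_order x y (\<alpha> x)))"
proof (cases "\<alpha> permutes {1..n}")
  case True
  then have perm: "permutation \<alpha>"
    by (auto intro: permutation_permutes[THEN iffD2])
  define c where "c a = set (support \<alpha> a)" for a
  have c_range: "c a = range (\<lambda>t. (\<alpha> ^^ t) a)" for a
    unfolding c_def by (rule support_set[OF perm])
  have self: "a \<in> c a" for a
    unfolding c_range by (rule image_eqI[of _ _ 0]) auto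
  have c_eq: "c b = c a" if "b \<in> c a" for a b
  proof -
    have "c b \<inter> c a \<noteq> {}"
      using that self by blast
    then show ?thesis
      using disjoint_support[OF perm] unfolding c_def disjoint_def by blast
  qed
  have c_step: "c (\<alpha> x) = c x" for x
    by (rule c_eq) (auto simp: c_range intro: image_eqI[of _ _ 1])
  have c_sub: "c a \<subseteq> {1..n}" if "a \<in> {1..n}" for a
  proof -
    have "(\<alpha> ^^ t) a \<in> {1..n}" for t
      using that by (induction t) (simp_all only: funpow.simps id_apply comp_apply permutes_in_image[OF True])
    then show ?thesis
      unfolding c_range by auto
  qed
  have pow: "(\<alpha> ^^ least_power \<alpha> a) a = a" "least_power \<alpha> a > 0" for a
    by (rule least_power_of_permutation[OF perm])+
  \<comment> \<open>The cycle is listed from its minimum \<open>a\<close>. Either \<open>x\<close>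
    is the last entry and its arrow returns to \<open>a\<close>, or the arrow goes to the next
    entry; no entry is passed over in either case.\<close>
  have cyc: "\<not> cyclic_order x y (\<alpha> x)"
    if sorted: "\<forall>a\<in>{1..n}. (\<forall>b\<in>c a. a \<le> b) \<longrightarrow> sorted_wrt (<) (support \<alpha> a)"
      and x: "x \<in> {1..n}" and y: "c x = c y" for x y
  proof -
    define a where "a = Min (c x)"
    have fin: "finite (c x)"
      unfolding c_def by simp
    have a: "a \<in> c x"
      unfolding a_def using fin self[of x] by (intro Min_in) auto
    have ca: "c a = c x"
      by (rule c_eq[OF a])
    have min: "\<forall>b\<in>c a. a \<le> b"
      unfolding ca using fin by (auto simp: a_def)
    have "a \<in> {1..n}"
      using a c_sub[OF x] by blast
    then have srt: "sorted_wrt (<) (support \<alpha> a)"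
      using sorted min by blast
    have mono: "(\<alpha> ^^ s) a < (\<alpha> ^^ t) a" if "s < t" "t < least_power \<alpha> a" for s t
      using sorted_wrt_nth_less[OF srt, of s t] that by simp
    obtain s t where s: "x = (\<alpha> ^^ s) a" "s < least_power \<alpha> a"
      and t: "y = (\<alpha> ^^ t) a" "t < least_power \<alpha> a"
      using self[of x] self[of y] unfolding y[symmetric] ca[symmetric] unfolding c_def by auto
    show ?thesis
    proof (cases "Suc s = least_power \<alpha> a")
      case True
      then have "\<alpha> x = a"
        using pow(1)[of a] s(1) by (metis comp_apply funpow.simps(2))
      moreover have "y \<le> x"
        using mono[of t s] s t True by (cases "t = s") auto
      moreover have "a \<le> y"
        using min self[of y] y ca by auto
      ultimately show ?thesis
        by (auto simp: cyclic_order_def)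
    next
      case False
      then have lt: "Suc s < least_power \<alpha> a"
        using s(2) by simp
      have "\<alpha> x = (\<alpha> ^^ Suc s) a"
        using s(1) by simp
      moreover have "x < \<alpha> x"
        using mono[of s "Suc s"] lt calculation s(1) by simp
      moreover have "y \<le> x \<or> \<alpha> x \<le> y"
      proof (cases "t \<le> s")
        case True
        then show ?thesis
          using mono[of t s] s t by (cases "t = s") auto
      next
        case False
        then show ?thesis
          using mono[of "Suc s" t] t calculation(1) by (cases "t = Suc s") auto
      qed
      ultimately show ?thesis
        by (auto simp: cyclic_order_def)
    qed
  qed
  have srt: "sorted_wrt (<) (support \<alpha> a)"
    if const: "\<forall>x\<in>{1..n}. l (\<alpha> x) = l x"
      and cyc: "\<forall>x\<in>{1..n}. \<forall>y\<in>{1..n}. l x = l y \<longrightarrow> \<not> cyclic_order x y (\<alpha> x)"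
      and a: "a \<in> {1..n}" and min: "\<forall>b\<in>c a. a \<le> b"
    for l :: "nat \<Rightarrow> nat set" and a
  proof -
    have orbit: "(\<alpha> ^^ t) a \<in> c a" for t
      unfolding c_range by blast
    then have mem: "(\<alpha> ^^ t) a \<in> {1..n}" for t
      using c_sub[OF a] by blast
    have l: "l ((\<alpha> ^^ t) a) = l a" for t
      by (induction t) (use const mem in auto)
    have "(\<alpha> ^^ t) a < (\<alpha> ^^ Suc t) a" if t: "Suc t < least_power \<alpha> a" for t
    proof (rule ccontr)
      assume not_less: "\<not> ?thesis"
      have ne: "(\<alpha> ^^ Suc t) a \<noteq> a"
        using least_power_le[where f = \<alpha> and n = "Suc t" and x = a] t by auto
      then have "a < (\<alpha> ^^ Suc t) a"
        using min orbit[of "Suc t"] by fastforce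
      moreover have "(\<alpha> ^^ Suc t) a \<noteq> (\<alpha> ^^ t) a"
      proof
        assume eq: "(\<alpha> ^^ Suc t) a = (\<alpha> ^^ t) a"
        then have "(\<alpha> ^^ t) (\<alpha> a) = (\<alpha> ^^ t) a"
          by (simp add: funpow_swap1)
        moreover have "inj (\<alpha> ^^ t)"
          by (rule inj_fn[OF permutes_inj[OF True]])
        ultimately have "\<alpha> a = a"
          by (simp add: inj_eq)
        then have "(\<alpha> ^^ u) a = a" for u
          by (induction u) auto
        then show False
          using ne by blast
      qed
      \<comment> \<open>A descent before the cycle closes ends above the minimum \<open>a\<close>,
        so it passes over \<open>a\<close>, which carries the same label.\<close>
      ultimately have "cyclic_order ((\<alpha> ^^ t) a) a (\<alpha> ((\<alpha> ^^ t) a))"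
        using not_less by (auto simp: cyclic_order_def)
      then show False
        using cyc mem a l by blast
    qed
    then show ?thesis
      by (subst sorted_wrt_iff_nth_Suc_transp) (auto simp: transp_def)
  qed
  show ?thesis (is "_ \<longleftrightarrow> ?R")
  proof
    assume "perm_partition n \<alpha>"
    then show ?R
      using True cyc c_step unfolding perm_partition_def c_def[symmetric]
      by (intro conjI exI[of _ c]) auto
  next
    assume ?R
    then show "perm_partition n \<alpha>"
      using True srt unfolding perm_partition_def c_def[symmetric] by auto
  qed
qed (simp add: perm_partition_def)


section \<open>Removal of a parallel pair in the old labels\<close>

text \<open>Once \<open>i\<close> and \<open>j\<close> are deleted, an arrow that ended in one of them ends in its cyclic successor. This
  describes both the new permutation and the new \<open>zeta\<close> in terms of the old labels.\<close>

definition bypass :: "nat \<Rightarrow> nat \<Rightarrow> nat \<Rightarrow> nat \<Rightarrow> nat" where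
  "bypass n i j = id(i := zeta n i, j := zeta n j)"

text \<open>Neither deleted point is mapped to a deleted point, so an arrow is redirected at most
  once.\<close>

lemma delete_two_from_cycles:
  assumes "f i \<notin> {i, j}" "f j \<notin> {i, j}" "x \<notin> {i, j}" "i \<noteq> j"
  shows "delete_from_cycle i (delete_from_cycle j f) x = (id(i := f i, j := f j)) (f x)"
  using assms by (auto simp: delete_from_cycle_def)

lemma reduced_partition_permutes: "reduced_partition n \<alpha> \<Longrightarrow> \<alpha> permutes {1..n}"
  by (simp add: reduced_partition_def perm_partition_def)

lemma reduced_partition_neq:
  assumes "reduced_partition n \<alpha>" "x \<in> {1..n}"
  shows "\<alpha> x \<noteq> x" "\<alpha> x \<noteq> zeta n x"
  using assms by (auto simp: reduced_partition_def reduced_perm_def fixed_pt_def dual_fixed_pt_def)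

lemma parallel_pairD:
  assumes "parallel_pair n \<alpha> i j"
  shows "i \<in> {1..n}" "j \<in> {1..n}" "i \<noteq> j" "\<alpha> i = zeta n j" "\<alpha> j = zeta n i"
  using assms by (auto simp: parallel_pair_def)

text \<open>As \<open>zeta n i = \<alpha> j\<close>, the value \<open>j\<close> would be a fixed
  point of \<open>\<alpha>\<close>; and \<open>zeta n i = i\<close> forces \<open>n = 1\<close>,
  which leaves no room for two points.\<close>

lemma zeta_notin_parallel_pair:
  assumes "reduced_partition n \<alpha>" "parallel_pair n \<alpha> i j"
  shows "zeta n i \<notin> {i, j}" "zeta n j \<notin> {i, j}"
proof -
  note p = parallel_pairD[OF assms(2)]
  have "zeta n i \<noteq> i" "zeta n j \<noteq> j"
    using p(1-3) by (auto simp: zeta_eq)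
  then show "zeta n i \<notin> {i, j}" "zeta n j \<notin> {i, j}"
    using reduced_partition_neq(1)[OF assms(1) p(1)] reduced_partition_neq(1)[OF assms(1) p(2)] p(4,5)
    by auto
qed

lemma gamma_eq_comp_transpose:
  "parallel_pair n \<alpha> i j \<Longrightarrow> gamma n i j \<alpha> = \<alpha> \<circ> transpose i j"
  by (auto simp: gamma_def parallel_pair_def transpose_def)

lemma skip_pair_notin: "i \<noteq> j \<Longrightarrow> skip_pair i j k \<notin> {i, j}"
  using range_skip_pair[of i j] by blast

lemma skip_pair_remove_pair:
  assumes "\<alpha> permutes {1..n}" "parallel_pair n \<alpha> i j"
  shows "skip_pair i j (remove_pair n i j \<alpha> k) =
    delete_from_cycle i (delete_from_cycle j (\<alpha> \<circ> transpose i j)) (skip_pair i j k)"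
proof -
  have "inj (\<alpha> \<circ> transpose i j)"
    using permutes_inj[OF assms(1)] by (simp add: inj_compose)
  then show ?thesis
    using parallel_pairD(3)[OF assms(2)] unfolding remove_pair_def gamma_eq_comp_transpose[OF assms(2)]
    by (rule skip_pair_remove_points)
qed

lemma skip_pair_remove_pair_bypass:
  assumes "reduced_partition n \<alpha>" "parallel_pair n \<alpha> i j"
  shows "skip_pair i j (remove_pair n i j \<alpha> k) = bypass n i j (\<alpha> (skip_pair i j k))"
proof -
  note p = parallel_pairD[OF assms(2)]
  show ?thesis
    using zeta_notin_parallel_pair[OF assms] skip_pair_notin[OF p(3), of k] p(3-5)
    unfolding skip_pair_remove_pair[OF reduced_partition_permutes[OF assms(1)] assms(2)] bypass_def
    by (subst delete_two_from_cycles) auto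
qed

text \<open>The smaller \<open>zeta\<close> arises by the same redirection as the smaller
  permutation. Equations between \<open>\<alpha>\<close> and \<open>zeta n\<close> therefore survive
  the removal: \<open>bypass\<close> is applied to both sides.\<close>

lemma skip_pair_zeta:
  assumes "reduced_partition n \<alpha>" "parallel_pair n \<alpha> i j"
  shows "skip_pair i j (zeta (n - 2) k) = bypass n i j (zeta n (skip_pair i j k))"
proof -
  note p = parallel_pairD[OF assms(2)]
  have "max i j \<in> {1..n}" "min i j \<in> {1..n - 1}"
    using p by auto
  then have "remove_point (min i j) (remove_point (max i j) (zeta n)) = zeta (n - 2)"
    by (simp only: remove_point_zeta) (simp add: numeral_2_eq_2)
  then show ?thesis
    using skip_pair_remove_points[OF permutes_inj[OF zeta_permutes[of n]] p(3), of k]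
      zeta_notin_parallel_pair[OF assms] skip_pair_notin[OF p(3), of k] p(3)
    unfolding bypass_def by (simp add: delete_two_from_cycles)
qed

lemma remove_pair_permutes:
  assumes "\<alpha> permutes {1..n}" "parallel_pair n \<alpha> i j"
  shows "remove_pair n i j \<alpha> permutes {1..n - 2}"
proof -
  note p = parallel_pairD[OF assms(2)]
  have "gamma n i j \<alpha> permutes {1..n}"
    unfolding gamma_eq_comp_transpose[OF assms(2)]
    using permutes_compose[OF permutes_swap_id[OF p(1,2)] assms(1)] .
  moreover have "max i j \<in> {1..n}" "min i j \<in> {1..n - 1}"
    using p by auto
  ultimately have "remove_pair n i j \<alpha> permutes {1..n - 1 - 1}"
    unfolding remove_pair_def by (intro remove_point_permutes)
  then show ?thesis
    by (simp add: numeral_2_eq_2)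
qed

lemma parallel_pair_remove_pair:
  assumes "reduced_partition n \<alpha>" "parallel_pair n \<alpha> i j"
    and "parallel_pair n \<alpha> (skip_pair i j k) (skip_pair i j l)"
  shows "parallel_pair (n - 2) (remove_pair n i j \<alpha>) k l"
  unfolding parallel_pair_def
proof (intro conjI)
  note p = parallel_pairD[OF assms(2)] and q = parallel_pairD[OF assms(3)]
  show "k \<in> {1..n - 2}" "l \<in> {1..n - 2}" "k \<noteq> l"
    using q skip_pair_mem_iff[OF p(1-3)] by blast+
  show "remove_pair n i j \<alpha> k = zeta (n - 2) l" "remove_pair n i j \<alpha> l = zeta (n - 2) k"
    by (rule strict_mono_imp_inj_on[OF strict_mono_skip_pair[of i j], THEN injD],
        simp add: skip_pair_remove_pair_bypass[OF assms(1,2)] skip_pair_zeta[OF assms(1,2)] q)+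
qed

section \<open>The merged cycle and the stability of reduced partitions\<close>

lemma cyclic_order_strict_mono:
  "strict_mono e \<Longrightarrow> cyclic_order (e x) (e y) (e z) \<longleftrightarrow> cyclic_order x y z"
  by (simp add: cyclic_order_def strict_mono_less)

lemma bypass_eqD:
  assumes "bypass n i j u = bypass n i j v" "zeta n i \<noteq> zeta n j" "u \<noteq> v"
  shows "{u, v} = {i, zeta n i} \<or> {u, v} = {j, zeta n j}"
  using assms by (auto simp: bypass_def split: if_splits)

lemma cyclic_order_rotate: "cyclic_order x y z \<Longrightarrow> cyclic_order y z x"
  by (auto simp: cyclic_order_def)

lemma cyclic_order_linear:
  "x \<noteq> y \<Longrightarrow> y \<noteq> z \<Longrightarrow> x \<noteq> z \<Longrightarrow> cyclic_order x y z \<or> cyclic_order x z y"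
  by (auto simp: cyclic_order_def)

text \<open>The four points occur in the order \<open>x, y, z, w\<close>; here \<open>z\<close> is
  dropped, in the next lemma \<open>x\<close>.\<close>

lemma cyclic_order_trans: "cyclic_order x y z \<Longrightarrow> cyclic_order x z w \<Longrightarrow> cyclic_order x y w"
  by (auto simp: cyclic_order_def)

lemma cyclic_order_trans': "cyclic_order x y z \<Longrightarrow> cyclic_order x z w \<Longrightarrow> cyclic_order y z w"
  by (auto simp: cyclic_order_def)

lemma cyclic_order_zeta:
  assumes "i \<in> {1..n}" "x \<in> {1..n}" "x \<noteq> i" "x \<noteq> zeta n i"
  shows "cyclic_order i (zeta n i) x"
  using assms by (auto simp: cyclic_order_def zeta_eq split: if_splits)

text \<open>Here \<open>x\<close> and \<open>u = \<alpha> x\<close> belong to the cycle of \<open>i\<close>, and \<open>y\<close> to one of the two cycles to be joined. As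
  \<open>x\<close> and \<open>u\<close> lie in the cyclic interval \<open>[j + 1, i]\<close> and the way from \<open>x\<close> to \<open>u\<close> does not pass \<open>i\<close>, it avoids
  the complementary interval \<open>[i + 1, j]\<close>, which contains the cycle of \<open>j\<close>.\<close>

lemma merged_cycle_increasing:
  assumes mem: "i \<in> {1..n}" "j \<in> {1..n}" "y \<in> {1..n}"
    and ne: "i \<noteq> j" "zeta n i \<notin> {i, j}" "zeta n j \<notin> {i, j}"
    and x: "x \<noteq> i" "\<not> cyclic_order i x (zeta n j)"
    and u: "u \<notin> {j, x}" "\<not> cyclic_order x i u"
    and y: "y \<noteq> i" "\<not> cyclic_order x y u \<or> \<not> cyclic_order j y (zeta n i)"
  shows "\<not> cyclic_order x y (bypass n i j u)"
proof
  assume *: "cyclic_order x y (bypass n i j u)"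
  let ?w = "zeta n i" and ?z = "zeta n j"
  \<comment> \<open>If \<open>u = i\<close>, the redirected arrow ends at \<open>?w\<close>, just
    behind \<open>i\<close>, and \<open>y\<close> is not \<open>i\<close>. Otherwise the arrow is
    unchanged and ends before \<open>i\<close>.\<close>
  have "cyclic_order x y i"
  proof (cases "u = i")
    case True
    then have "cyclic_order ?w x y"
      using * ne(1) cyclic_order_rotate by (fastforce simp: bypass_def)
    moreover have "cyclic_order i ?w y"
      using cyclic_order_zeta[OF mem(1,3) y(1)] calculation by (auto simp: cyclic_order_def)
    ultimately show ?thesis
      by (meson cyclic_order_rotate cyclic_order_trans cyclic_order_trans')
  next
    case False
    then have "cyclic_order x y u"
      using * u by (simp add: bypass_def)
    moreover have "cyclic_order x u i"
      using cyclic_order_linear[of x u i] u False x by auto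
    ultimately show ?thesis
      by (rule cyclic_order_trans)
  qed
  \<comment> \<open>The interval of the cycle of \<open>i\<close> starts at \<open>?z\<close>, so
    \<open>y\<close>, lying between \<open>x\<close> and \<open>i\<close>, cannot be in the
    complementary interval from \<open>?w\<close> to \<open>j\<close>.\<close>
  moreover have "x = ?z \<or> cyclic_order i ?z x"
    using cyclic_order_linear[of i x ?z] x ne by auto
  ultimately have "cyclic_order i ?z y"
    by (meson cyclic_order_rotate cyclic_order_trans)
  moreover have "cyclic_order i j ?z"
    using cyclic_order_zeta[OF mem(2,1)] ne by (auto intro: cyclic_order_rotate)
  ultimately have "cyclic_order i j y"
    by (rule cyclic_order_trans[rotated])
  moreover have "cyclic_order i ?w j"
    using cyclic_order_zeta[OF mem(1,2)] ne by auto
  ultimately have "cyclic_order j y ?w"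
    by (meson cyclic_order_rotate cyclic_order_trans')
  \<comment> \<open>The arrow before redirection already passes over \<open>y\<close>, so both
    alternatives assumed for \<open>y\<close> fail.\<close>
  moreover have "cyclic_order x y u"
  proof (cases "u = i")
    case True
    then show ?thesis using \<open>cyclic_order x y i\<close> by simp
  next
    case False
    then show ?thesis
      using * u by (simp add: bypass_def)
  qed
  ultimately show False
    using y by blast
qed

text \<open>Everything is checked in the old labels, where \<open>x\<close> now goes to
  \<open>bypass n i j (\<alpha> x)\<close>. The labels of \<open>i\<close> and \<open>j\<close> are
  identified and all other labels are kept.\<close>

lemma reduced_partition_remove_pair:
  assumes red: "reduced_partition n \<alpha>" and par: "parallel_pair n \<alpha> i j"
  shows "reduced_partition (n - 2) (remove_pair n i j \<alpha>)"
proof -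
  note p = parallel_pairD[OF par] and z = zeta_notin_parallel_pair[OF red par]
  have perm: "\<alpha> permutes {1..n}"
    by (rule reduced_partition_permutes[OF red])
  let ?\<beta> = "remove_pair n i j \<alpha>" and ?e = "skip_pair i j"
  note img = skip_pair_remove_pair_bypass[OF red par] skip_pair_zeta[OF red par]
  have mem: "?e k \<in> {1..n} \<longleftrightarrow> k \<in> {1..n - 2}" for k
    by (rule skip_pair_mem_iff[OF p(1-3)])
  have out: "?e k \<noteq> i" "?e k \<noteq> j" for k
    using skip_pair_notin[OF p(3)] by auto
  have mem_\<alpha>: "\<alpha> x \<in> {1..n}" if "x \<in> {1..n}" for x
    using that permutes_in_image[OF perm] by blast
  have inj: "\<alpha> x = \<alpha> y \<longleftrightarrow> x = y" for x y
    using permutes_inj[OF perm] by (simp add: inj_eq)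
  have "perm_partition n \<alpha>"
    using red by (simp add: reduced_partition_def)
  then obtain c :: "nat \<Rightarrow> nat set" where c: "\<And>x. x \<in> {1..n} \<Longrightarrow> c (\<alpha> x) = c x"
    and cyc: "\<And>x y. x \<in> {1..n} \<Longrightarrow> y \<in> {1..n} \<Longrightarrow> c x = c y \<Longrightarrow> \<not> cyclic_order x y (\<alpha> x)"
    unfolding perm_partition_iff_labelling by metis
  have cz: "c (zeta n j) = c i" "c (zeta n i) = c j"
    using c[OF p(1)] c[OF p(2)] unfolding p(4,5) .
  have z_mem: "zeta n i \<in> {1..n}" "zeta n j \<in> {1..n}"
    using mem_\<alpha>[OF p(2)] mem_\<alpha>[OF p(1)] unfolding p(4,5) .
  have z_ne: "zeta n i \<noteq> zeta n j"
    using p(3) inj[of i j] unfolding p(4,5) by auto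
  \<comment> \<open>With equal labels, the arrow from \<open>i\<close> to \<open>zeta n j\<close>
    would pass over \<open>zeta n i\<close>, which has the label of \<open>j\<close>.\<close>
  have ne: "c i \<noteq> c j"
  proof
    assume "c i = c j"
    then have "\<not> cyclic_order i (zeta n i) (zeta n j)"
      using cyc[OF p(1) z_mem(1)] cz p by simp
    then show False
      using cyclic_order_zeta[OF p(1) z_mem(2)] z z_ne by auto
  qed
  \<comment> \<open>Stated for an arbitrary parallel pair, to be used for \<open>(i, j)\<close> when
    \<open>x\<close> is labelled like \<open>i\<close> and for \<open>(j, i)\<close> when it is
    labelled like \<open>j\<close>.\<close>
  have merge: "\<not> cyclic_order x y (bypass n i' j' (\<alpha> x))"
    if par': "parallel_pair n \<alpha> i' j'" and x: "x \<in> {1..n}" "x \<notin> {i', j'}" "c x = c i'"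
      and y: "y \<in> {1..n}" "y \<notin> {i', j'}" "c y \<in> {c i', c j'}" and ne': "c i' \<noteq> c j'"
    for i' j' x y
  proof (rule merged_cycle_increasing)
    note p' = parallel_pairD[OF par']
    show "i' \<in> {1..n}" "j' \<in> {1..n}" "y \<in> {1..n}" "i' \<noteq> j'" "x \<noteq> i'" "y \<noteq> i'"
      using p' x y by auto
    show "zeta n i' \<notin> {i', j'}" "zeta n j' \<notin> {i', j'}"
      by (rule zeta_notin_parallel_pair[OF red par'])+
    show "\<not> cyclic_order i' x (zeta n j')"
      using cyc[OF p'(1) x(1)] x p' by simp
    show "\<alpha> x \<notin> {j', x}"
      using c[OF x(1)] x ne' reduced_partition_neq(1)[OF red x(1)] by auto
    show "\<not> cyclic_order x i' (\<alpha> x)"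
      using cyc[OF x(1) p'(1)] x by simp
    show "\<not> cyclic_order x y (\<alpha> x) \<or> \<not> cyclic_order j' y (zeta n i')"
      using y(3) cyc[OF x(1) y(1)] cyc[OF p'(2) y(1)] p'(5) x(3) by auto
  qed
  have par': "parallel_pair n \<alpha> j i"
    using par by (auto simp: parallel_pair_def)
  have bypass_swap: "bypass n j i = bypass n i j"
    using p(3) unfolding bypass_def by (rule fun_upd_twist[symmetric])
  define c' where "c' k = (if c (?e k) = c j then c i else c (?e k))" for k
  \<comment> \<open>Redirection from \<open>i\<close> to \<open>zeta n i\<close> changes the label
    from that of \<open>i\<close> to that of \<open>j\<close>, and vice versa; only the union of the
    two classes is preserved.\<close>
  have c_bypass: "c (bypass n i j v) \<in> {c i, c j} \<longleftrightarrow> c v \<in> {c i, c j}"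
    "c v \<notin> {c i, c j} \<Longrightarrow> bypass n i j v = v" for v
    using cz by (auto simp: bypass_def)
  have c'_step: "c' (?\<beta> k) = c' k" if k: "k \<in> {1..n - 2}" for k
  proof -
    have "c (\<alpha> (?e k)) = c (?e k)"
      by (rule c) (use k mem in blast)
    then show ?thesis
      unfolding c'_def img using c_bypass[of "\<alpha> (?e k)"] by (cases "c (?e k) \<in> {c i, c j}") auto
  qed
  have c'_cyc: "\<not> cyclic_order k l (?\<beta> k)"
    if k: "k \<in> {1..n - 2}" and l: "l \<in> {1..n - 2}" and eq: "c' k = c' l" for k l
  proof -
    have kl: "?e k \<in> {1..n}" "?e l \<in> {1..n}"
      using k l mem by auto
    have notin: "?e k \<notin> {i, j}" "?e l \<notin> {i, j}"
      using out by blast+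
    have classes: "c (?e k) \<in> {c i, c j} \<and> c (?e l) \<in> {c i, c j} \<or>
        c (?e k) \<notin> {c i, c j} \<and> c (?e k) = c (?e l)"
      using eq unfolding c'_def by (metis insert_iff singletonD)
    have "\<not> cyclic_order (?e k) (?e l) (bypass n i j (\<alpha> (?e k)))"
    proof -
      consider "c (?e k) = c i" "c (?e l) \<in> {c i, c j}" | "c (?e k) = c j" "c (?e l) \<in> {c j, c i}"
        | "c (?e k) \<notin> {c i, c j}" "c (?e k) = c (?e l)"
        using classes by blast
      then show ?thesis
      proof cases
        case 1
        then show ?thesis
          by (intro merge[OF par kl(1) notin(1) _ kl(2) notin(2)] ne)
      next
        case 2
        then show ?thesis
          unfolding bypass_swap[symmetric]
          by (intro merge[OF par' kl(1) _ _ kl(2)] ne[symmetric]) (use notin in blast)+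
      next
        case 3
        then have "bypass n i j (\<alpha> (?e k)) = \<alpha> (?e k)"
          by (intro c_bypass(2)) (simp add: c[OF kl(1)])
        then show ?thesis
          using cyc[OF kl 3(2)] by simp
      qed
    qed
    then show ?thesis
      unfolding img(1)[symmetric] by (simp add: cyclic_order_strict_mono[OF strict_mono_skip_pair])
  qed
  \<comment> \<open>The distinct points \<open>i\<close>, \<open>j\<close>, \<open>zeta n i\<close>
    give \<open>3 \<le> n\<close>, so the truncated subtraction is harmless.\<close>
  have "1 \<le> n - 2"
  proof -
    have "card {i, j, zeta n i} \<le> card {1..n}"
      using p z_mem by (intro card_mono) auto
    then show ?thesis
      using p z by simp
  qed
  then have "perm_partition (n - 2) ?\<beta>"
    unfolding perm_partition_iff_labelling
    by (intro conjI exI[of _ c'] ballI impI remove_pair_permutes[OF perm par] c'_step c'_cyc)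
  moreover have "?\<beta> k \<noteq> k" if k: "k \<in> {1..n - 2}" for k
  proof
    assume "?\<beta> k = k"
    then have fixed: "bypass n i j (\<alpha> (?e k)) = ?e k"
      using img(1)[of k] by simp
    have k': "?e k \<in> {1..n}"
      using k mem by blast
    \<comment> \<open>A new fixed point would be the successor of the deleted point it used to map
      to; but that successor carries the other of the two labels.\<close>
    have "\<alpha> (?e k) = i \<and> zeta n i = ?e k \<or> \<alpha> (?e k) = j \<and> zeta n j = ?e k"
      using fixed reduced_partition_neq(1)[OF red k'] by (auto simp: bypass_def split: if_splits)
    then show False
      using c[OF k'] cz ne by metis
  qed
  moreover have "?\<beta> k \<noteq> zeta (n - 2) k" if k: "k \<in> {1..n - 2}" for k
  proof
    assume "?\<beta> k = zeta (n - 2) k"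
    then have dual: "bypass n i j (\<alpha> (?e k)) = bypass n i j (zeta n (?e k))"
      using img[of k] by simp
    have k': "?e k \<in> {1..n}"
      using k mem by blast
    have zeta_inj: "zeta n x = zeta n y \<longleftrightarrow> x = y" for x y
      using permutes_inj[OF zeta_permutes] by (simp add: inj_eq)
    \<comment> \<open>\<open>bypass\<close> identifies \<open>i\<close> only with
      \<open>zeta n i\<close> and \<open>j\<close> only with \<open>zeta n j\<close>. These
      successors are the images of \<open>i\<close> and \<open>j\<close> under
      \<open>zeta n\<close>, and of \<open>j\<close> and \<open>i\<close> under
      \<open>\<alpha>\<close>, so a remaining point reaches neither.\<close>
    have "zeta n (?e k) \<notin> {zeta n i, zeta n j}" "\<alpha> (?e k) \<notin> {zeta n i, zeta n j}"
      using out[of k] zeta_inj inj p(4,5) by (metis empty_iff insert_iff)+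
    then show False
      using bypass_eqD[OF dual z_ne reduced_partition_neq(2)[OF red k']] by (auto simp: doubleton_eq_iff)
  qed
  ultimately show ?thesis
    by (auto simp: reduced_partition_def reduced_perm_def fixed_pt_def dual_fixed_pt_def)
qed

section \<open>Commutation of the removals of two pairs\<close>

lemma range_skip_two_pairs:
  assumes "i \<noteq> j" "k' \<noteq> l'" "skip_pair i j k' = k" "skip_pair i j l' = l"
  shows "range (skip_pair i j \<circ> skip_pair k' l') = - {i, j, k, l}"
proof -
  have "skip_pair i j ` (- {k', l'}) = - {i, j} - {k, l}"
    using image_set_diff[OF strict_mono_imp_inj_on[OF strict_mono_skip_pair], of i j UNIV "{k', l'}"]
    unfolding range_skip_pair[OF assms(1)] Compl_eq_Diff_UNIV[of "{k', l'}"] image_insert image_empty assms(3,4) .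
  also have "\<dots> = - {i, j, k, l}"
    by auto
  finally show ?thesis
    unfolding image_comp[symmetric] range_skip_pair[OF assms(2)] .
qed

text \<open>The second removal is transported to the original labels, and its transposition is moved
  inside the deletions of \<open>i\<close> and \<open>j\<close>, which it does not touch. What
  remains is four deletions after two transpositions.\<close>

lemma skip_two_pairs_remove_pairs:
  assumes red: "reduced_partition n \<alpha>"
    and ij: "parallel_pair n \<alpha> i j" and kl: "parallel_pair n \<alpha> k l" and disj: "{i, j} \<inter> {k, l} = {}"
    and k: "skip_pair i j k' = k" and l: "skip_pair i j l' = l"
  shows "skip_pair i j (skip_pair k' l' (remove_pair (n - 2) k' l' (remove_pair n i j \<alpha>) x)) =
    delete_from_cycle k (delete_from_cycle l (delete_from_cycle i (delete_from_cycle j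
      (\<alpha> \<circ> transpose i j \<circ> transpose k l)))) (skip_pair i j (skip_pair k' l' x))"
proof -
  note perm = reduced_partition_permutes[OF red]
  let ?e = "skip_pair i j" and ?\<beta> = "remove_pair n i j \<alpha>"
  let ?g = "delete_from_cycle i (delete_from_cycle j (\<alpha> \<circ> transpose i j)) \<circ> transpose k l"
  have e_inj: "?e u = ?e v \<longleftrightarrow> u = v" for u v
    by (rule strict_mono_eq[OF strict_mono_skip_pair])
  have kl': "parallel_pair (n - 2) ?\<beta> k' l'"
    using parallel_pair_remove_pair[OF red ij] kl k l by simp
  have "?e (transpose k' l' v) = transpose k l (?e v)" for v
    using k l e_inj by (auto simp: transpose_def)
  then have \<beta>: "?e ((?\<beta> \<circ> transpose k' l') v) = ?g (?e v)" for v
    by (simp add: skip_pair_remove_pair[OF perm ij])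
  have D: "?e (delete_from_cycle u f v) = delete_from_cycle (?e u) g (?e v)"
    if "\<And>v. ?e (f v) = g (?e v)" for u v f g
    using e_inj that[symmetric] by (simp add: delete_from_cycle_def)
  have "?e (delete_from_cycle l' (?\<beta> \<circ> transpose k' l') v) = delete_from_cycle l ?g (?e v)" for v
    using D[where f = "?\<beta> \<circ> transpose k' l'" and g = ?g and u = l'] \<beta> l by blast
  then have "?e (delete_from_cycle k' (delete_from_cycle l' (?\<beta> \<circ> transpose k' l')) v) =
      delete_from_cycle k (delete_from_cycle l ?g) (?e v)" for v
    using D[where f = "delete_from_cycle l' (?\<beta> \<circ> transpose k' l')" and g = "delete_from_cycle l ?g" and u = k'] k
    by blast
  moreover have "?g = delete_from_cycle i (delete_from_cycle j (\<alpha> \<circ> transpose i j \<circ> transpose k l))"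
    using disj by (simp add: delete_from_cycle_transpose)
  ultimately show ?thesis
    using skip_pair_remove_pair[OF remove_pair_permutes[OF perm ij] kl'] by simp
qed

text \<open>Both sides have the same form in the original labels: disjoint transpositions commute,
  deletions commute, and the two composite relabellings enumerate the complement of the same four
  points increasingly.\<close>

lemma remove_pair_commute:
  assumes red: "reduced_partition n \<alpha>"
    and ij: "parallel_pair n \<alpha> i j" and kl: "parallel_pair n \<alpha> k l" and disj: "{i, j} \<inter> {k, l} = {}"
    and eqs: "skip_pair i j k' = k" "skip_pair i j l' = l" "skip_pair k l i' = i" "skip_pair k l j' = j"
  shows "remove_pair (n - 2) k' l' (remove_pair n i j \<alpha>) =
    remove_pair (n - 2) i' j' (remove_pair n k l \<alpha>)"
proof
  fix x
  have disj': "{k, l} \<inter> {i, j} = {}"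
    using disj by auto
  have ne: "i \<noteq> j" "k \<noteq> l" "i' \<noteq> j'" "k' \<noteq> l'"
    using ij kl eqs by (auto simp: parallel_pair_def)
  have "skip_pair i j \<circ> skip_pair k' l' = skip_pair k l \<circ> skip_pair i' j'"
  proof (rule strict_mono_range_unique)
    show "range (skip_pair i j \<circ> skip_pair k' l') = range (skip_pair k l \<circ> skip_pair i' j')"
      using range_skip_two_pairs[OF ne(1,4) eqs(1,2)] range_skip_two_pairs[OF ne(2,3) eqs(3,4)] by auto
  qed (intro strict_mono_o strict_mono_skip_pair)+
  then have E: "skip_pair i j (skip_pair k' l' v) = skip_pair k l (skip_pair i' j' v)" for v
    by (metis comp_apply)
  let ?g = "\<alpha> \<circ> transpose i j \<circ> transpose k l"
  have swap: "\<alpha> \<circ> transpose k l \<circ> transpose i j = ?g"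
    using disj by (auto simp: transpose_def fun_eq_iff)
  have inj: "inj ?g"
    using permutes_inj[OF reduced_partition_permutes[OF red]] by (simp add: inj_compose)
  have D: "delete_from_cycle k (delete_from_cycle l (delete_from_cycle i (delete_from_cycle j ?g))) =
      delete_from_cycle i (delete_from_cycle j (delete_from_cycle k (delete_from_cycle l ?g)))"
    by (metis delete_from_cycle_commute inj inj_delete_from_cycle)
  have "skip_pair k l (skip_pair i' j' (remove_pair (n - 2) k' l' (remove_pair n i j \<alpha>) x)) =
      skip_pair k l (skip_pair i' j' (remove_pair (n - 2) i' j' (remove_pair n k l \<alpha>) x))"
    using skip_two_pairs_remove_pairs[OF red ij kl disj eqs(1,2), of x]
      skip_two_pairs_remove_pairs[OF red kl ij disj' eqs(3,4), of x]
    unfolding D swap E by simp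
  then show "remove_pair (n - 2) k' l' (remove_pair n i j \<alpha>) x =
      remove_pair (n - 2) i' j' (remove_pair n k l \<alpha>) x"
    by (simp add: strict_mono_eq[OF strict_mono_skip_pair])
qed

section \<open>Diamond property, termination and uniqueness\<close>

lemma remove_pair_swap: "i \<noteq> j \<Longrightarrow> remove_pair n j i \<alpha> = remove_pair n i j \<alpha>"
  by (simp add: remove_pair_def gamma_def max.commute min.commute fun_upd_twist)

lemma parallel_removal_diamond:
  assumes "parallel_removal a b" "parallel_removal a c" "b \<noteq> c"
  shows "\<exists>d. parallel_removal b d \<and> parallel_removal c d"
proof -
  obtain n \<alpha> i j where a: "a = (n, \<alpha>)" and b: "b = (n - 2, remove_pair n i j \<alpha>)"
    and red: "reduced_partition n \<alpha>" and ij: "parallel_pair n \<alpha> i j"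
    using assms(1) by cases auto
  obtain k l where c: "c = (n - 2, remove_pair n k l \<alpha>)" and kl: "parallel_pair n \<alpha> k l"
    using assms(2) a by cases auto
  note p = parallel_pairD[OF ij] and q = parallel_pairD[OF kl]
  have zeta_inj: "zeta n x = zeta n y \<longleftrightarrow> x = y" for x y
    using permutes_inj[OF zeta_permutes] by (simp add: inj_eq)
  have "(k, l) \<noteq> (i, j)" "(k, l) \<noteq> (j, i)"
    using assms(3) b c remove_pair_swap[OF p(3)] by auto
  \<comment> \<open>By \<open>\<alpha> i = zeta n j\<close> and injectivity of
    \<open>zeta n\<close>, a point determines its partner, so two different pairs are
    disjoint.\<close>
  then have disj: "{i, j} \<inter> {k, l} = {}"
    using p(4,5) q(4,5) zeta_inj by auto
  have "k \<in> range (skip_pair i j)" "l \<in> range (skip_pair i j)"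
    "i \<in> range (skip_pair k l)" "j \<in> range (skip_pair k l)"
    using disj by (auto simp: range_skip_pair p q)
  then obtain k' l' i' j' where eqs: "skip_pair i j k' = k" "skip_pair i j l' = l"
    "skip_pair k l i' = i" "skip_pair k l j' = j"
    by (metis rangeE)
  have "parallel_pair (n - 2) (remove_pair n i j \<alpha>) k' l'"
    using parallel_pair_remove_pair[OF red ij] kl eqs by simp
  then have "parallel_removal b (n - 2 - 2, remove_pair (n - 2) k' l' (remove_pair n i j \<alpha>))"
    unfolding b by (rule parallel_removal.intros[OF reduced_partition_remove_pair[OF red ij]])
  moreover have "parallel_pair (n - 2) (remove_pair n k l \<alpha>) i' j'"
    using parallel_pair_remove_pair[OF red kl] ij eqs by simp
  then have "parallel_removal c (n - 2 - 2, remove_pair (n - 2) i' j' (remove_pair n k l \<alpha>))"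
    unfolding c by (rule parallel_removal.intros[OF reduced_partition_remove_pair[OF red kl]])
  ultimately show ?thesis
    unfolding remove_pair_commute[OF red ij kl disj eqs] by blast
qed

text \<open>The diamond closes with one step on each side, or with none if \<open>b = c\<close>;
  this is strong confluence.\<close>

lemma confluentp_parallel_removal: "confluentp parallel_removal"
proof (intro strong_confluentp_imp_confluentp strong_confluentpI)
  fix a b c
  assume "parallel_removal a b" "parallel_removal a c"
  then show "\<exists>d. parallel_removal\<^sup>*\<^sup>* b d \<and> parallel_removal\<^sup>=\<^sup>= c d"
    using parallel_removal_diamond[of a b c] by (cases "b = c") blast+
qed

lemma parallel_removal_reduced:
  assumes "parallel_removal\<^sup>*\<^sup>* s t" "reduced_partition (fst s) (snd s)"
  shows "reduced_partition (fst t) (snd t)"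
  using assms by (induction rule: rtranclp_induct)
    (auto elim!: parallel_removal.cases intro: reduced_partition_remove_pair)

lemma ex_primitive_partition:
  assumes "reduced_partition n \<alpha>"
  shows "\<exists>m \<beta>. primitive_partition m \<beta> \<and> parallel_removal\<^sup>*\<^sup>* (n, \<alpha>) (m, \<beta>)"
  using assms
proof (induction n arbitrary: \<alpha> rule: less_induct)
  case (less n)
  show ?case
  proof (cases "\<exists>i j. parallel_pair n \<alpha> i j")
    case True
    then obtain i j where ij: "parallel_pair n \<alpha> i j"
      by blast
    \<comment> \<open>The point \<open>i\<close> in \<open>{1..n}\<close> gives
      \<open>n > 0\<close>, so the degree really drops.\<close>
    have "n - 2 < n"
      using parallel_pairD(1)[OF ij] by auto
    then obtain m \<beta> where "primitive_partition m \<beta>"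
      "parallel_removal\<^sup>*\<^sup>* (n - 2, remove_pair n i j \<alpha>) (m, \<beta>)"
      using less.IH reduced_partition_remove_pair[OF less.prems ij] by blast
    then show ?thesis
      using parallel_removal.intros[OF less.prems ij] by (meson converse_rtranclp_into_rtranclp)
  next
    case False
    then show ?thesis
      using less.prems unfolding primitive_partition_def by blast
  qed
qed

lemma primitive_partition_no_removal:
  assumes "primitive_partition m \<beta>" "parallel_removal\<^sup>*\<^sup>* (m, \<beta>) t"
  shows "t = (m, \<beta>)"
  using assms(2)
proof (cases rule: converse_rtranclpE)
  case (step u)
  then show ?thesis
    using assms(1) by (auto simp: primitive_partition_def elim: parallel_removal.cases)
qed simp

text \<open>The second conjunct says that removals get stuck only at primitive partitions. As the
  degree drops each time, every order of removals ends in the unique pair of the first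
  conjunct.\<close>

theorem proposition5p7:
  fixes n :: nat and \<alpha> :: "nat \<Rightarrow> nat"
  assumes "1 \<le> n" and "reduced_partition n \<alpha>"
  shows "(\<exists>!(m, \<beta>). primitive_partition m \<beta> \<and> parallel_removal\<^sup>*\<^sup>* (n, \<alpha>) (m, \<beta>)) \<and>
         (\<forall>m \<beta>. parallel_removal\<^sup>*\<^sup>* (n, \<alpha>) (m, \<beta>) \<and> (\<nexists>s. parallel_removal (m, \<beta>) s)
            \<longrightarrow> primitive_partition m \<beta>)"
proof (intro conjI allI impI)
  \<comment> \<open>Confluence gives a common descendant of \<open>s\<close> and \<open>t\<close>; a
    primitive partition has no descendant but itself.\<close>
  have unique: "s = t"
    if "primitive_partition (fst s) (snd s)" "parallel_removal\<^sup>*\<^sup>* (n, \<alpha>) s"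
      "primitive_partition (fst t) (snd t)" "parallel_removal\<^sup>*\<^sup>* (n, \<alpha>) t" for s t
    using confluentpD[OF confluentp_parallel_removal that(2,4)]
      primitive_partition_no_removal[OF that(1)] primitive_partition_no_removal[OF that(3)] by (metis prod.collapse)
  obtain m \<beta> where "primitive_partition m \<beta>" "parallel_removal\<^sup>*\<^sup>* (n, \<alpha>) (m, \<beta>)"
    using ex_primitive_partition[OF assms(2)] by blast
  then show "\<exists>!(m, \<beta>). primitive_partition m \<beta> \<and> parallel_removal\<^sup>*\<^sup>* (n, \<alpha>) (m, \<beta>)"
    using unique by (intro ex1I[of _ "(m, \<beta>)"]) (auto split: prod.splits)
  show "primitive_partition m \<beta>"
    if "parallel_removal\<^sup>*\<^sup>* (n, \<alpha>) (m, \<beta>) \<and> (\<nexists>s. parallel_removal (m, \<beta>) s)" for m \<beta>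
  proof -
    have "reduced_partition m \<beta>"
      using parallel_removal_reduced[of "(n, \<alpha>)" "(m, \<beta>)"] that assms(2) by simp
    then show ?thesis
      using that parallel_removal.intros unfolding primitive_partition_def by blast
  qed
qed

end
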